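(* For all $k,\ell\in\mathbb{N}$ with $2\leq\ell\leq k$, we have \[ S_2(k;\ell)\geq k^2+\left[\frac{(\ell+1)(\ell-2)}{2}+2\right]k+\ell(\ell-2). \] Furthermore, for every fixed integer $\ell\geq 2$ there exists $K\in\mathbb{N}$ (depending on $\ell$) such that for all integers $k\geq K$ with $k\geq \ell$ we have \[ S_2(k;\ell)= k^2+\left[\frac{(\ell+1)(\ell-2)}{2}+2\right]k+\ell(\ell-2). \] In particular, $S_2(k;2)=k^2+2k$ for all integers $k\geq3$.
   Context: $\mathbb{N}=\{1,2,\ldots\}$ is the set of positive integers. For $n,r\in\mathbb{N}$, an $r$-coloring of $\{1,\ldots,n\}$ is a function $\Delta:\{1,\ldots,n\}\to\{1,\ldots,r\}$. For $k\geq 2$ consider the equation \[ x_1+x_2+\cdots+x_k=x_{k+1}\qquad( * ) \] in which the variables are not required to be distinct. A solution $\mathcal{S}$ to $( * )$ in $\{1,\ldots,n\}$ (i.e. a tuple $(x_1,\ldots,x_{k+1})$ of elements of $\{1,\ldots,n\}$ satisfying $( * )$) is monochromatic under $\Delta$ if all integers occurring in it have the same color. For a solution $\mathcal{S}$, $c(\mathcal{S})$ denotes the number of distinct integers occurring among $x_1,\ldots,x_{k+1}$. For $r,k,\ell\in\mathbb{N}$ with $\ell\leq k$ and $k\geq2$, $S_r(k;\ell)$ denotes the smallest $n\in\mathbb{N}$, if it exists, such that every $r$-coloring of $\{1,2,\ldots,n\}$ has a monochromatic solution $\mathcal{S}$ to $( * )$ with $c(\mathcal{S})=\ell+1$. (The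 number $S_r(k;\ell)$ exists whenever $\ell\geq 2$.) *)

theory Defs
  imports Complex_Main "HOL-Library.FuncSet"
begin

definition is_coloring :: "nat \<Rightarrow> nat \<Rightarrow> (nat \<Rightarrow> nat) \<Rightarrow> bool" where
  "is_coloring r n \<Delta> \<longleftrightarrow> \<Delta> \<in> {1..n} \<rightarrow>\<^sub>E {1..r}"

(* The tuple (x_1, ..., x_{k+1}) is encoded as a function on the index set {1..k+1}. *)
definition is_solution :: "nat \<Rightarrow> nat \<Rightarrow> (nat \<Rightarrow> nat) \<Rightarrow> bool" where
  "is_solution k n x \<longleftrightarrow> x \<in> {1..k+1} \<rightarrow>\<^sub>E {1..n} \<and> (\<Sum>i=1..k. x i) = x (k+1)"

definition monochromatic :: "nat \<Rightarrow> (nat \<Rightarrow> nat) \<Rightarrow> (nat \<Rightarrow> nat) \<Rightarrow> bool" where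
  "monochromatic k \<Delta> x \<longleftrightarrow> (\<forall>i\<in>{1..k+1}. \<forall>j\<in>{1..k+1}. \<Delta> (x i) = \<Delta> (x j))"

definition num_distinct :: "nat \<Rightarrow> (nat \<Rightarrow> nat) \<Rightarrow> nat" where
  "num_distinct k x = card (x ` {1..k+1})"

definition forces_solution :: "nat \<Rightarrow> nat \<Rightarrow> nat \<Rightarrow> nat \<Rightarrow> bool" where
  "forces_solution r k l n \<longleftrightarrow>
     (\<forall>\<Delta>. is_coloring r n \<Delta> \<longrightarrow>
        (\<exists>x. is_solution k n x \<and> monochromatic k \<Delta> x \<and> num_distinct k x = l + 1))"

(* Inf is the minimum of a nonempty set of naturals and Inf {} = 0; as the minimum is
   taken over positive n, the value is 0 exactly if no such n exists. Hence a positive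
   lower bound on schur_number r k l also asserts that the number exists. *)
definition schur_number :: "nat \<Rightarrow> nat \<Rightarrow> nat \<Rightarrow> nat" where
  "schur_number r k l = Inf {n. n \<ge> 1 \<and> forces_solution r k l n}"

end

theory Submission
  imports Defs "HOL-Library.Multiset" "HOL-Library.Ramsey"
begin

text \<open>
  With \<open>T = l (l - 1) / 2\<close> and \<open>M = k + T\<close>, the smallest sum of \<open>k\<close> positive integers taking exactly
  \<open>l\<close> values is \<open>M\<close>, and the smallest such sum of integers \<open>\<ge> M\<close> is \<open>P = k M + T\<close>. Colouring
  \<open>[M, P)\<close> blue and everything else red postpones the next red sum to \<open>P + (k - 1) + (l - 1) (l - 2) / 2\<close>,
  the claimed value.

  For the upper bound and large \<open>k\<close>, consider the colours of \<open>1, \<dots>, 4 l\<^sup>2\<close>. If \<open>1, \<dots>, l + 1\<close> have one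
  colour, the colours in the extremal example are forced and the claimed value can have neither colour. If
  both colours occur at least \<open>l\<close> times, sums of one colour that use one large sum of the other colour
  produce a number that can have neither colour; the parity colouring needs a variant of this. If one
  colour is rare but occurs among \<open>1, \<dots>, l + 1\<close>, then large sums of the frequent colour combine with
  the rare element to a sum of the frequent colour.

  For arbitrary \<open>k\<close>, the existence of the number follows from Ramsey's theorem, applied to the colours of
  \<open>d, p d, p\<^sup>2 d\<close> for differences \<open>d\<close> of powers of \<open>p + 2\<close>, where \<open>p = k - l + 1\<close>.
\<close>

subsection \<open>Colourings without monochromatic solutions\<close>

text \<open>\<open>X\<close> consists of the \<open>k\<close> summands. Their sum differs from each of them as \<open>k \<ge> 2\<close>, so that
  \<open>l\<close> distinct summands amount to \<open>l + 1\<close> distinct integers.\<close>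
definition avoids :: "nat \<Rightarrow> nat \<Rightarrow> nat \<Rightarrow> (nat \<Rightarrow> bool) \<Rightarrow> bool" where
  "avoids k l n c \<longleftrightarrow>
     \<not> (\<exists>X. size X = k \<and> card (set_mset X) = l \<and> 0 \<notin># X \<and> sum_mset X \<le> n \<and>
          (\<forall>x\<in>#X. c x = c (sum_mset X)))"

lemma num_distinct_solution:
  assumes "k \<ge> 2" and "is_solution k n x"
  shows "num_distinct k x = card (x ` {1..k}) + 1"
proof -
  have pos: "x i \<ge> 1" if "i \<in> {1..k}" for i
    using assms(2) that by (auto simp: is_solution_def PiE_iff)
  have "x i < x (k + 1)" if i: "i \<in> {1..k}" for i
  proof -
    obtain j where j: "j \<in> {1..k}" "j \<noteq> i"
      using assms(1) i by (cases "i = 1") (auto intro: that[of 1] that[of 2])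
    have "x i + x j = (\<Sum>i\<in>{i, j}. x i)" using j by simp
    also have "\<dots> \<le> (\<Sum>i=1..k. x i)" using i j by (intro sum_mono2) auto
    finally show ?thesis using pos[OF j(1)] assms(2) by (simp add: is_solution_def)
  qed
  then have "x (k + 1) \<notin> x ` {1..k}" by force
  moreover have "{1..k+1} = insert (k + 1) {1..k}" by auto
  ultimately show ?thesis by (simp add: num_distinct_def)
qed

text \<open>The order of the summands is irrelevant, so a tuple becomes the multiset of its first
  \<open>k\<close> entries, and two colours become a truth value. Conversely, listing a multiset in
  any order yields a tuple.\<close>

lemma forces_solution_2_iff:
  assumes "k \<ge> 2"
  shows "forces_solution 2 k l n \<longleftrightarrow> (\<forall>c. \<not> avoids k l n c)"
proof
  assume F: "forces_solution 2 k l n"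
  show "\<forall>c. \<not> avoids k l n c"
  proof
    fix c
    define \<Delta> where "\<Delta> = (\<lambda>i\<in>{1..n}. if c i then 1 else 2 :: nat)"
    have "is_coloring 2 n \<Delta>" by (auto simp: is_coloring_def \<Delta>_def)
    with F obtain x where x: "is_solution k n x" "Defs.monochromatic k \<Delta> x" "num_distinct k x = l + 1"
      unfolding forces_solution_def by blast
    define X where "X = image_mset x (mset_set {1..k})"
    have set: "set_mset X = x ` {1..k}" by (simp add: X_def)
    have sum: "sum_mset X = x (k + 1)"
      using x(1) by (simp add: X_def is_solution_def sum_unfold_sum_mset)
    have ran: "x i \<in> {1..n}" if "i \<in> {1..k+1}" for i
      using x(1) that by (auto simp: is_solution_def PiE_iff)
    have col: "c (x i) = c (x (k + 1))" if "i \<in> {1..k}" for i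
    proof -
      have "i \<in> {1..k+1}" "k + 1 \<in> {1..k+1}" using that by auto
      then have "\<Delta> (x i) = \<Delta> (x (k + 1))" "x i \<in> {1..n}" "x (k + 1) \<in> {1..n}"
        using x(2) ran unfolding Defs.monochromatic_def by blast+
      then have "(if c (x i) then 1 else 2 :: nat) = (if c (x (k + 1)) then 1 else 2)"
        unfolding \<Delta>_def restrict_apply by presburger
      then show ?thesis by (auto split: if_splits)
    qed
    have "size X = k" by (simp add: X_def)
    moreover have "card (set_mset X) = l"
      using num_distinct_solution[OF assms x(1)] x(3) set by simp
    moreover have "0 \<notin># X" using ran by (force simp: set)
    moreover have "sum_mset X \<le> n" using ran[of "k + 1"] sum by simp
    moreover have "\<forall>x\<in>#X. c x = c (sum_mset X)" using col by (auto simp: set sum)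
    ultimately show "\<not> avoids k l n c" unfolding avoids_def by blast
  qed
next
  assume A: "\<forall>c. \<not> avoids k l n c"
  show "forces_solution 2 k l n"
    unfolding forces_solution_def
  proof (intro allI impI)
    fix \<Delta> assume \<Delta>: "is_coloring 2 n \<Delta>"
    from A have "\<not> avoids k l n (\<lambda>i. \<Delta> i = 1)" by blast
    then obtain X where X: "size X = k" "card (set_mset X) = l" "0 \<notin># X" "sum_mset X \<le> n"
      "\<forall>x\<in>#X. (\<Delta> x = 1) = (\<Delta> (sum_mset X) = 1)"
      unfolding avoids_def by blast
    obtain xs where xs: "mset xs = X" using ex_mset by blast
    have len: "length xs = k" using X(1) xs by auto
    define x where "x = (\<lambda>i\<in>{1..k+1}. if i = k + 1 then sum_mset X else xs ! (i - 1))"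
    have im: "x ` {1..k} = set_mset X"
    proof -
      have "x ` {1..k} = (\<lambda>i. xs ! (i - 1)) ` {1..k}" by (auto simp: x_def intro!: image_cong)
      also have "\<dots> = (\<lambda>i. xs ! i) ` ((\<lambda>i. i - 1) ` {1..k})" by (simp add: image_image)
      also have "(\<lambda>i. i - 1) ` {1..k} = {..<k}"
        by (auto simp: image_iff intro!: bexI[of _ "Suc _"])
      also have "(\<lambda>i. xs ! i) ` {..<k} = set xs" using len by (auto simp: set_conv_nth)
      finally show ?thesis using xs by auto
    qed
    have last: "x (k + 1) = sum_mset X" by (simp add: x_def)
    have le: "y \<in> {1..n}" if "y \<in># X" for y
    proof -
      have "y \<le> sum_mset X" using that by (metis le_add1 multi_member_split sum_mset.add_mset)
      moreover have "y \<noteq> 0" using that X(3) by metis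
      ultimately show ?thesis using X(4) by simp
    qed
    have "\<exists>y. y \<in># X" using X(1) assms by (metis not_numeral_le_zero multiset_nonemptyE size_empty)
    then obtain y where "y \<in># X" by blast
    have "y \<le> sum_mset X" using \<open>y \<in># X\<close> by (metis le_add1 multi_member_split sum_mset.add_mset)
    then have sX: "sum_mset X \<in> {1..n}" using le[OF \<open>y \<in># X\<close>] X(4) by simp
    have all: "x i \<in># X \<or> x i = sum_mset X" if "i \<in> {1..k+1}" for i
      using that im last by (cases "i = k + 1") force+
    have sol: "is_solution k n x"
      unfolding is_solution_def
    proof
      show "x \<in> {1..k+1} \<rightarrow>\<^sub>E {1..n}"
      proof (rule PiE_I)
        show "x i \<in> {1..n}" if "i \<in> {1..k+1}" for i
          using all[OF that] le sX by metis
        show "x i = undefined" if "i \<notin> {1..k+1}" for i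
          using that unfolding x_def restrict_apply by (rule if_not_P)
      qed
      have "(\<Sum>i=1..k. x i) = (\<Sum>i=1..k. xs ! (i - 1))" by (intro sum.cong) (auto simp: x_def)
      also have "\<dots> = (\<Sum>i<k. xs ! i)"
        by (rule sum.reindex_bij_witness[of _ Suc "\<lambda>i. i - 1"]) auto
      also have "\<dots> = sum_list xs" using len by (simp add: sum_list_sum_nth atLeast0LessThan)
      finally show "(\<Sum>i=1..k. x i) = x (k + 1)" using xs last by (metis sum_mset_sum_list)
    qed
    have two: "\<Delta> y = 1 \<or> \<Delta> y = 2" if "y \<in> {1..n}" for y
    proof -
      have "\<Delta> y \<in> {1..2}" using \<Delta> that by (auto simp: is_coloring_def PiE_iff)
      then show ?thesis by auto
    qed
    have "\<Delta> (x i) = \<Delta> (sum_mset X)" if "i \<in> {1..k+1}" for i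
      using all[OF that] X(5) two[OF sX] two[OF le, of "x i"] by auto
    then have "Defs.monochromatic k \<Delta> x" by (simp add: Defs.monochromatic_def)
    then show "\<exists>x. is_solution k n x \<and> Defs.monochromatic k \<Delta> x \<and> num_distinct k x = l + 1"
      using sol num_distinct_solution[OF assms sol] im X(2) by auto
  qed
qed

lemma avoids_mono: "avoids k l n c \<Longrightarrow> m \<le> n \<Longrightarrow> avoids k l m c"
  unfolding avoids_def using order_trans by blast

section \<open>Sums with prescribed multiplicities\<close>

lemma avoids_sum_mset:
  assumes "avoids k l n c" "size X = k" "card (set_mset X) = l"
    and "\<And>x. x \<in># X \<Longrightarrow> x > 0 \<and> c x = d" and "sum_mset X \<le> n"
  shows "c (sum_mset X) \<noteq> d"
  using assms unfolding avoids_def by (metis less_irrefl)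

text \<open>Each element of \<open>V\<close> is used once. Of the \<open>k - l\<close> remaining
  summands, \<open>s\<close> equal \<open>b\<close> and the others equal \<open>a\<close>, so
  varying \<open>s\<close> moves the sum in steps of \<open>b - a\<close>.\<close>

lemma avoids_sum:
  assumes "avoids k l n c" "l \<le> k" "finite V" "card V = l"
    and "\<And>v. v \<in> V \<Longrightarrow> v > 0 \<and> c v = d"
    and "a \<in> V" "b \<in> V" "a \<le> b" "s \<le> k - l" "z = \<Sum>V + (k - l) * a + s * (b - a)" "z \<le> n"
  shows "c z \<noteq> d"
proof -
  define X where "X = mset_set V + replicate_mset (k - l - s) a + replicate_mset s b"
  have "set_mset X = V" using assms by (auto simp: X_def)
  moreover have "size X = k" using assms by (simp add: X_def)
  moreover have "sum_mset X = z"
  proof -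
    obtain r where r: "k - l = s + r" using assms(9) le_Suc_ex by blast
    obtain e where e: "b = a + e" using assms(8) le_Suc_ex by blast
    have "sum_mset X = \<Sum>V + r * a + s * b" by (simp add: X_def sum_unfold_sum_mset r)
    then show ?thesis using assms(10) by (simp add: r e algebra_simps)
  qed
  ultimately show ?thesis using avoids_sum_mset[OF assms(1), of X d] assms by simp
qed

lemma avoids_sum_const:
  assumes "avoids k l n c" "1 \<le> l" "l \<le> k" "finite V" "card V = l - 1" "x \<notin> V"
    and "\<And>v. v \<in> V \<Longrightarrow> v > 0 \<and> c v = d" "x > 0" "c x = d"
    and "z = \<Sum>V + (k - l + 1) * x" "z \<le> n"
  shows "c z \<noteq> d"
  using assms by (intro avoids_sum[OF assms(1,3), of "insert x V" d x x 0]) auto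

lemma avoids_sum_2:
  assumes "avoids k 2 n c" "c a = d" "c b = d" "a \<noteq> b" "a > 0" "b > 0"
    and "i \<ge> 1" "j \<ge> 1" "i + j = k" "i * a + j * b \<le> n"
  shows "c (i * a + j * b) \<noteq> d"
proof -
  have "set_mset (replicate_mset i a + replicate_mset j b) = {a, b}" using assms by auto
  then show ?thesis
    using avoids_sum_mset[OF assms(1), of "replicate_mset i a + replicate_mset j b" d] assms by auto
qed

subsection \<open>The lower bound\<close>

text \<open>Induction by removing the maximum, which is at least \<open>m + card V - 1\<close>
  because \<open>V\<close> lies between \<open>m\<close> and it.\<close>

lemma sum_ge_card:
  fixes V :: "nat set"
  assumes "finite V" "\<And>v. v \<in> V \<Longrightarrow> m \<le> v"
  shows "card V * m + card V * (card V - 1) div 2 \<le> \<Sum>V"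
  using assms
proof (induction "card V" arbitrary: V)
  case 0
  then show ?case by simp
next
  case (Suc j)
  define W where "W = V - {Max V}"
  have ne: "V \<noteq> {}" using Suc by auto
  have Max: "Max V \<in> V" using ne Suc by simp
  have cW: "card W = j" using Suc Max by (simp add: W_def)
  have IH: "j * m + j * (j - 1) div 2 \<le> \<Sum>W"
    using Suc(1)[of W] cW Suc(3,4) by (auto simp: W_def)
  have "V \<subseteq> {m..Max V}" using Suc by auto
  then have "card V \<le> Suc (Max V) - m" by (metis card_mono card_atLeastAtMost finite_atLeastAtMost)
  then have "m + j \<le> Max V" using Suc(2) by linarith
  moreover have "\<Sum>V = Max V + \<Sum>W" using Max Suc(3) by (simp add: W_def sum.remove)
  moreover have "Suc j * (Suc j - 1) div 2 = j + j * (j - 1) div 2"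
    by (cases j) (auto simp: algebra_simps)
  ultimately show ?case using IH Suc(2)[symmetric] by (simp add: algebra_simps)
qed

text \<open>One copy of each value is bounded by \<open>sum_ge_card\<close>; every further copy
  contributes at least \<open>m\<close>.\<close>

lemma sum_mset_ge:
  fixes X :: "nat multiset"
  assumes "\<And>x. x \<in># X \<Longrightarrow> m \<le> x" "l \<le> card (set_mset X)"
  shows "size X * m + l * (l - 1) div 2 \<le> sum_mset X"
proof -
  define Y where "Y = X - mset_set (set_mset X)"
  have X: "X = mset_set (set_mset X) + Y" by (simp add: Y_def mset_set_set_mset_msubset)
  have "size Y * m \<le> sum_mset Y"
  proof -
    have "y \<ge> m" if "y \<in># Y" for y using that assms(1) in_diffD unfolding Y_def by metis
    then show ?thesis by (induction Y) (auto simp: algebra_simps add_mono)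
  qed
  moreover have "card (set_mset X) * m + card (set_mset X) * (card (set_mset X) - 1) div 2 \<le> \<Sum>(set_mset X)"
    using assms by (intro sum_ge_card) auto
  moreover have "l * (l - 1) div 2 \<le> card (set_mset X) * (card (set_mset X) - 1) div 2"
    using assms(2) by (intro div_le_mono mult_mono) auto
  moreover have "size X = card (set_mset X) + size Y" by (metis X size_union size_mset_set)
  moreover have "sum_mset X = \<Sum>(set_mset X) + sum_mset Y"
    by (metis X sum_mset.union sum_unfold_sum_mset image_mset.identity id_apply multiset.map_ident)
  ultimately show ?thesis by (simp add: algebra_simps)
qed

text \<open>The claimed value within the naturals:
  \<open>(l + 1) (l - 2) / 2 + 2 = l (l - 1) / 2 + 1\<close>, and \<open>l (l - 1)\<close> is
  even.\<close>

definition schur_bound :: "nat \<Rightarrow> nat \<Rightarrow> nat" where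
  "schur_bound k l = k ^ 2 + (l * (l - 1) div 2 + 1) * k + l * (l - 2)"

text \<open>The form that the extremal colouring produces: the endpoint \<open>P\<close> plus the
  least sum of \<open>k - 1\<close> positive integers with \<open>l - 1\<close> values.\<close>

lemma schur_bound_alt:
  assumes "2 \<le> l" "1 \<le> k"
  shows "schur_bound k l = k * (k + l * (l - 1) div 2) + l * (l - 1) div 2
           + (k - 1) + (l - 1) * (l - 2) div 2"
proof -
  obtain j where l: "l = j + 2" using assms(1) by (metis add.commute le_Suc_ex)
  obtain i where k: "k = Suc i" using assms(2) by (cases k) auto
  have "even (j * (j + 1))" by simp
  then obtain h where h: "j * (j + 1) = 2 * h" by (elim evenE)
  have "l * (l - 1) = 2 * (h + j + 1)" "(l - 1) * (l - 2) = 2 * h"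
    using h by (auto simp: l algebra_simps)
  then have "l * (l - 1) div 2 = h + j + 1" "(l - 1) * (l - 2) div 2 = h" by simp_all
  moreover have "l * (l - 2) = 2 * h + j" using h by (simp add: l algebra_simps)
  ultimately show ?thesis unfolding schur_bound_def k by (simp add: algebra_simps power2_eq_square)
qed

lemma real_schur_bound:
  assumes "2 \<le> l"
  shows "real (schur_bound k l) = real k ^ 2 + ((real l + 1) * (real l - 2) / 2 + 2) * real k + real l * (real l - 2)"
proof -
  have "2 dvd l * (l - 1)" by (cases "even l") auto
  then have "real (l * (l - 1) div 2) = real (l * (l - 1)) / 2" by (metis of_nat_numeral real_of_nat_div)
  also have "\<dots> = real l * (real l - 1) / 2" using assms by (simp add: of_nat_diff)
  finally have *: "real (l * (l - 1) div 2) = real l * (real l - 1) / 2" .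
  show ?thesis using assms by (simp only: schur_bound_def of_nat_add of_nat_mult of_nat_power *)
      (simp add: of_nat_diff field_simps)
qed

lemma avoids_below_bound:
  assumes l: "2 \<le> l" and lk: "l \<le> k"
  defines "M \<equiv> k + l * (l - 1) div 2"
  defines "P \<equiv> k * M + l * (l - 1) div 2"
  shows "avoids k l (schur_bound k l - 1) (\<lambda>x. M \<le> x \<and> x < P)"
proof -
  have False
    if X: "size X = k" "card (set_mset X) = l" "0 \<notin># X" "sum_mset X \<le> schur_bound k l - 1"
      "\<forall>x\<in>#X. (M \<le> x \<and> x < P) = (M \<le> sum_mset X \<and> sum_mset X < P)" for X
  proof (cases "M \<le> sum_mset X \<and> sum_mset X < P")
    case True
    then have "k * M + l * (l - 1) div 2 \<le> sum_mset X"
      using sum_mset_ge[of X M l] X by auto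
    then show False using True by (simp add: P_def)
  next
    case False
    have pos: "1 \<le> x" if "x \<in># X" for x using that X(3) by (cases x) auto
    \<comment> \<open>No sum with \<open>l\<close> values falls below \<open>M\<close>, so a red sum
      must lie beyond the blue block.\<close>
    have "M \<le> sum_mset X" using sum_mset_ge[of X 1 l] pos X by (simp add: M_def)
    with False have PX: "P \<le> sum_mset X" by simp
    show False
    proof (cases "\<exists>x. x \<in># X \<and> P \<le> x")
      case True
      then obtain x where x: "x \<in># X" "P \<le> x" by blast
      then obtain Y where Y: "X = add_mset x Y" by (metis multi_member_split)
      \<comment> \<open>Removing one copy of \<open>x\<close> loses at most one value, so the other
        summands still cost their least possible sum.\<close>
      have "l - 1 \<le> card (set_mset Y)"
        using X(2) by (simp add: Y card_insert_if split: if_splits)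
      then have "k - 1 + (l - 1) * (l - 1 - 1) div 2 \<le> sum_mset Y"
        using sum_mset_ge[of Y 1 "l - 1"] pos X(1) by (auto simp: Y)
      then have "P + (k - 1) + (l - 1) * (l - 2) div 2 \<le> sum_mset X"
        using x by (simp add: Y numeral_2_eq_2)
      moreover have "schur_bound k l = P + (k - 1) + (l - 1) * (l - 2) div 2"
        using schur_bound_alt[of l k] l lk by (simp add: P_def M_def)
      moreover have "0 < schur_bound k l" using l lk by (simp add: schur_bound_def)
      ultimately show False using X(4) by linarith
    next
      case no: False
      have "x < M" if "x \<in># X" for x
      proof (rule ccontr)
        assume "\<not> x < M"
        then show False using that no X(5) False by (meson not_less)
      qed
      \<comment> \<open>Red summands below \<open>P\<close> are below \<open>M\<close>, so their sum
        is at most \<open>k * (M - 1)\<close>, which is less than \<open>P\<close>.\<close>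
      then have "sum_mset X + size X \<le> size X * M"
      proof (induction X)
        case (add x X)
        have "x < M" "\<And>y. y \<in># X \<Longrightarrow> y < M" using add.prems by auto
        with add.IH show ?case by force
      qed simp
      then show False using PX X(1) l lk by (simp add: P_def)
    qed
  qed
  then show ?thesis unfolding avoids_def by blast
qed

text \<open>The infimum of the empty set is 0, hence the existence hypothesis;
  \<open>ex_not_avoids\<close> supplies it for all \<open>k\<close>.\<close>

lemma schur_number_ge_bound:
  assumes "2 \<le> l" "l \<le> k" "\<exists>n. \<forall>c. \<not> avoids k l n c"
  shows "schur_bound k l \<le> schur_number 2 k l"
proof -
  let ?S = "{n. n \<ge> 1 \<and> forces_solution 2 k l n}"
  have k: "k \<ge> 2" using assms by simp
  have low: "schur_bound k l \<le> n" if "\<forall>c. \<not> avoids k l n c" for n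
    using that avoids_mono[OF avoids_below_bound[OF assms(1,2)], of n] by (cases "n \<le> schur_bound k l - 1") auto
  have "1 \<le> schur_bound k l" using k by (simp add: schur_bound_def)
  from assms(3) obtain n where n: "\<forall>c. \<not> avoids k l n c" by blast
  with low[OF n] \<open>1 \<le> schur_bound k l\<close> have "n \<in> ?S" by (simp add: forces_solution_2_iff[OF k])
  then have "?S \<noteq> {}" by blast
  then have "Inf ?S \<in> ?S" by (rule Inf_nat_def1)
  then show ?thesis using low forces_solution_2_iff[OF k] by (simp add: schur_number_def)
qed

lemma schur_number_eq_bound:
  assumes "2 \<le> l" "l \<le> k" "\<forall>c. \<not> avoids k l (schur_bound k l) c"
  shows "schur_number 2 k l = schur_bound k l"
proof (rule antisym)
  have "1 \<le> schur_bound k l" using assms by (simp add: schur_bound_def)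
  then show "schur_number 2 k l \<le> schur_bound k l"
    unfolding schur_number_def using assms forces_solution_2_iff[of k]
    by (intro cInf_lower) auto
  show "schur_bound k l \<le> schur_number 2 k l" using assms by (intro schur_number_ge_bound) blast+
qed

subsection \<open>Two distinct summands\<close>

text \<open>The result for large \<open>k\<close> does not reach down to \<open>k = 3\<close>. Here
  chains of forced colours, starting from those of 1, 2 and 3, are followed explicitly.\<close>

lemma not_avoids_2:
  assumes "3 \<le> k"
  shows "\<not> avoids k 2 (k ^ 2 + 2 * k) c"
proof
  assume A: "avoids k 2 (k ^ 2 + 2 * k) c"
  obtain m where m: "k = m + 3" using assms by (metis add.commute le_Suc_ex)
  define N where "N = m * m + 8 * m + 15"
  have N: "k ^ 2 + 2 * k = N" by (simp add: N_def m power2_eq_square algebra_simps)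
  note mn = N_def m algebra_simps
  have S: "c z \<noteq> d" if "c a = d" "c b = d" "a \<noteq> b" "a > 0" "b > 0"
    "i \<ge> 1" "j \<ge> 1" "i + j = k" "i * a + j * b = z" "z \<le> N" for a b i j z d
    using avoids_sum_2[OF A that(1-8)] that(9,10) N by simp
  define u where "u = c 1"
  have u1: "c 1 = u" by (simp add: u_def)
  show False
  proof (cases "c 2 = u")
    case u2: True
    have k1: "c (k + 1) \<noteq> u" by (rule S[OF u1 u2, of "k - 1" 1]) (auto simp: mn)
    have k2: "c (k + 2) \<noteq> u" by (rule S[OF u1 u2, of "k - 2" 2]) (auto simp: mn)
    have "c (N - k + 1) \<noteq> (\<not> u)"
      by (rule S[of "k + 1" _ "k + 2" "k - 1" 1]) (use k1 k2 in \<open>auto simp: mn\<close>)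
    then have Nu: "c N \<noteq> u"
      by (intro S[OF u1, of "N - k + 1" "k - 1" 1]) (auto simp: mn)
    show False
    proof (cases "c 3 = u")
      case True
      have k3: "c (2 * k + 1) \<noteq> u" by (rule S[OF u2 True, of "k - 1" 1]) (auto simp: mn)
      have "c N \<noteq> (\<not> u)"
        by (rule S[of "k + 1" _ "2 * k + 1" "k - 1" 1]) (use k1 k3 in \<open>auto simp: mn\<close>)
      with Nu show False by simp
    next
      case False
      show False
      \<comment> \<open>For \<open>k = 3\<close> the representation
        \<open>(k - 3) * 1 + 3 * 2\<close> of \<open>k + 3\<close> does not use the value 1, so 9
        and 11 take over.\<close>
      proof (cases "m = 0")
        case True
        have "c 9 = u"
          using S[of 3 "\<not> u" 9 2 1 15] False Nu by (auto simp: N_def m True)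
        then have "c 11 \<noteq> u"
          using S[of 1 u 9 2 1 11] u1 by (auto simp: N_def m True)
        moreover have "c 11 \<noteq> (\<not> u)"
          using S[of 3 "\<not> u" 5 2 1 11] False k2 by (auto simp: N_def m True)
        ultimately show False by simp
      next
        case m0: False
        have k3: "c (k + 3) \<noteq> u"
          by (rule S[OF u1 u2, of "k - 3" 3]) (use m0 in \<open>auto simp: mn\<close>)
        have "c N \<noteq> (\<not> u)"
          by (rule S[of 3 _ "k + 3" 1 "k - 1"]) (use False k3 in \<open>auto simp: mn\<close>)
        with Nu show False by simp
      qed
    qed
  next
    case u2: False
    \<comment> \<open>Adding \<open>k - 1\<close> and \<open>2 (k - 1)\<close> to \<open>b\<close>, in the order that colours permit,
      leads to the colour of \<open>b + 3 (k - 1)\<close>, which determines that of 3.\<close>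
    have red: "c 3 \<noteq> u" if b: "c b = u" "4 \<le> b" "b \<le> m * m + 5 * m + 9" for b
    proof
      assume u3: "c 3 = u"
      have "c (b + (k - 1)) \<noteq> u"
        by (rule S[OF u1 b(1), of "k - 1" 1]) (use b in \<open>auto simp: mn\<close>)
      then have "c (b + 3 * (k - 1)) \<noteq> (\<not> u)"
        by (intro S[of 2 _ "b + (k - 1)" "k - 1" 1]) (use b u2 in \<open>auto simp: mn\<close>)
      moreover have "c (b + 3 * (k - 1)) \<noteq> u"
        by (rule S[OF u3 b(1), of "k - 1" 1]) (use b in \<open>auto simp: mn\<close>)
      ultimately show False by simp
    qed
    have blue: "c 3 = u" if b: "c b \<noteq> u" "4 \<le> b" "b \<le> m * m + 5 * m + 9" for b
    proof (rule ccontr)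
      assume u3: "c 3 \<noteq> u"
      have "c (b + 2 * (k - 1)) \<noteq> (\<not> u)"
        by (rule S[of 2 _ b "k - 1" 1]) (use b u2 in \<open>auto simp: mn\<close>)
      then have "c (b + 3 * (k - 1)) \<noteq> u"
        by (intro S[of 1 _ "b + 2 * (k - 1)" "k - 1" 1]) (use b u1 in \<open>auto simp: mn\<close>)
      moreover have "c (b + 3 * (k - 1)) \<noteq> (\<not> u)"
        by (rule S[of 3 _ b "k - 1" 1]) (use b u3 in \<open>auto simp: mn\<close>)
      ultimately show False by simp
    qed
    show False
    proof (cases "c 3 = u")
      case True
      \<comment> \<open>The range ends at \<open>N - 3 * (k - 1)\<close>. It contains both 4 and
        \<open>2 * (k - 1) + 4\<close>, which contradicts the sum of \<open>k - 1\<close> twos and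
        one 4.\<close>
      then have all: "c b \<noteq> u" if "4 \<le> b" "b \<le> m * m + 5 * m + 9" for b using red that by blast
      have "c (2 * (k - 1) + 4) \<noteq> (\<not> u)"
        by (rule S[of 2 _ 4 "k - 1" 1]) (use all[of 4] u2 in \<open>auto simp: mn\<close>)
      then show False using all[of "2 * (k - 1) + 4"] by (simp add: m)
    next
      case False
      then have all: "c b = u" if "4 \<le> b" "b \<le> m * m + 5 * m + 9" for b using blue that by blast
      have "c ((k - 1) + 4) \<noteq> u"
        by (rule S[of 1 _ 4 "k - 1" 1]) (use all[of 4] u1 in \<open>auto simp: mn\<close>)
      then show False using all[of "(k - 1) + 4"] by (simp add: m)
    qed
  qed
qed

subsection \<open>Existence\<close>

lemma sum_telescope_nat:
  fixes a :: "nat \<Rightarrow> nat"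
  assumes "mono a"
  shows "(\<Sum>i<m. a (Suc (r + i)) - a (r + i)) = a (r + m) - a r"
proof (induction m)
  case (Suc m)
  have "a r \<le> a (r + m)" "a (r + m) \<le> a (Suc (r + m))" by (auto intro: monoD[OF assms])
  with Suc show ?case by simp
qed simp

text \<open>Consecutive differences add up to a difference. If differences and their \<open>p\<close>-multiples have the same
  colour, this yields a solution at once. Otherwise the colours of \<open>d\<close>, \<open>p d\<close>, \<open>p\<^sup>2 d\<close> alternate, and
  \<open>z = p d + p\<^sup>2 d'\<close> is both \<open>p\<close> times \<open>d\<close> plus pieces of \<open>p\<^sup>2 d'\<close>, and \<open>p\<close> times \<open>p d'\<close> plus
  pieces of \<open>p d\<close>.\<close>
lemma not_avoids_differences:
  fixes a :: "nat \<Rightarrow> nat"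
  assumes avoids: "avoids k l n c" and l: "2 \<le> l" "l \<le> k"
    and p: "p = k - l + 1"
    and pos: "\<And>i. 1 \<le> a i" and growth: "\<And>i. (p + 2) * a i \<le> a (Suc i)"
    and n: "(p * p + p) * a (2 * l - 2) \<le> n"
    and col: "\<And>i j. i < j \<Longrightarrow> j \<le> 2 * l - 2 \<Longrightarrow>
      c (a j - a i) = u0 \<and> c (p * (a j - a i)) = u1 \<and> c (p * p * (a j - a i)) = u2"
  shows False
proof -
  define d where "d i = a (Suc i) - a i" for i
  have p1: "1 \<le> p" by (simp add: p)
  have Suc_le: "a i \<le> a (Suc i)" for i using growth[of i] by simp
  have mono: "mono a" by (intro mono_iff_le_Suc[THEN iffD2] allI Suc_le)
  have d_ge: "(p + 1) * a i \<le> d i" for i using growth[of i] by (simp add: d_def algebra_simps)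
  have d_less: "d i < a (Suc i)" for i using pos[of i] Suc_le[of i] by (simp add: d_def)
  have "d i < d (Suc i)" for i
    using d_less[of i] d_ge[of "Suc i"] by simp
  then have strict: "strict_mono d" by (intro strict_mono_Suc_iff[THEN iffD2] allI)
  have d_le: "d i \<le> a j" if "i < j" for i j
    using d_less[of i] monoD[OF mono, of "Suc i" j] that by simp
  have d_pos: "0 < d i" for i using d_ge[of i] pos[of i] by (cases "d i") auto
  have cold: "c (d i) = u0 \<and> c (p * d i) = u1 \<and> c (p * p * d i) = u2" if "i < 2 * l - 2" for i
    using col[of i "Suc i"] that by (simp add: d_def)
  \<comment> \<open>A block of \<open>l - 1\<close> consecutive differences scaled by
    \<open>w\<close>; its sum telescopes to one scaled difference. Another \<open>p\<close> equal
    summands complete a sum of \<open>k\<close> terms.\<close>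
  define Y where "Y w r = (\<lambda>i. w * d (r + i)) ` {..<l - 1}" for w r
  have inj: "inj_on (\<lambda>i. w * d (r + i)) {..<l - 1}" if "1 \<le> w" for w r
    using that strict_mono_eq[OF strict] by (auto simp: inj_on_def)
  have card: "card (Y w r) = l - 1" if "1 \<le> w" for w r
    using inj[OF that] by (simp add: Y_def card_image)
  have sumY: "\<Sum>(Y w r) = w * (a (r + (l - 1)) - a r)" if "1 \<le> w" for w r
    using inj[OF that, of r] sum_telescope_nat[OF mono, of r "l - 1"]
    by (simp add: Y_def sum.reindex d_def flip: sum_distrib_left)
  have finY: "finite (Y w r)" for w r by (simp add: Y_def)
  note step = avoids_sum_const[OF avoids _ l(2) finY card, folded p]
  \<comment> \<open>If differences scaled by \<open>w\<close> and by \<open>p * w\<close> shared a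
    colour, then \<open>p * w * (a l - a 0)\<close> would split into \<open>l - 1\<close> pieces
    scaled by \<open>p * w\<close> and \<open>p\<close> copies of
    \<open>w * d (l - 1)\<close>.\<close>
  have scale: False if w: "w = 1 \<or> w = p" and eq: "\<And>i. i < 2 * l - 2 \<Longrightarrow> c (w * d i) = u \<and> c (p * w * d i) = u"
      "\<And>i j. i < j \<Longrightarrow> j \<le> 2 * l - 2 \<Longrightarrow> c (p * w * (a j - a i)) = u" for w u
  proof -
    have w1: "1 \<le> w" "w \<le> p" using w p1 by auto
    have "w * d (l - 1) \<notin> Y (p * w) 0"
    proof
      assume "w * d (l - 1) \<in> Y (p * w) 0"
      then obtain i where i: "i < l - 1" "w * d (l - 1) = p * w * d i" by (auto simp: Y_def)
      then have "d (l - 1) = p * d i" using w1 by (simp add: mult.assoc mult.left_commute)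
      also have "\<dots> \<le> p * a (l - 1)" using d_le[OF i(1)] by simp
      also have "\<dots> < d (l - 1)" using d_ge[of "l - 1"] pos[of "l - 1"] by simp
      finally show False by simp
    qed
    moreover have z: "p * w * (a l - a 0) = \<Sum>(Y (p * w) 0) + p * (w * d (l - 1))"
    proof -
      have "a 0 \<le> a (l - 1)" "a (l - 1) \<le> a l" by (auto intro: monoD[OF mono])
      then show ?thesis using l sumY[of "p * w" 0] w1 by (simp add: d_def flip: mult.assoc distrib_left)
    qed
    moreover have "p * w * (a l - a 0) \<le> n"
    proof -
      have "a l \<le> a (2 * l - 2)" using l by (intro monoD[OF mono]) linarith
      then have "a l - a 0 \<le> a (2 * l - 2)" by linarith
      then have "p * w * (a l - a 0) \<le> p * p * a (2 * l - 2)" using w1 by (intro mult_mono) auto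
      then show ?thesis using n by (simp add: algebra_simps)
    qed
    moreover have "v > 0 \<and> c v = u" if "v \<in> Y (p * w) 0" for v
      using that eq(1) d_pos w1 p1 by (auto simp: Y_def)
    ultimately have "c (p * w * (a l - a 0)) \<noteq> u"
      using l w1 p1 d_pos[of "l - 1"] eq(1)[of "l - 1"]
      by (intro step[of "p * w" "w * d (l - 1)" 0 u]) auto
    then show False using eq(2)[of 0 l] l by simp
  qed
  have "u0 \<noteq> u1" using scale[of 1 u0] cold col by auto
  moreover have "u1 \<noteq> u2" using scale[of p u1] cold col by auto
  ultimately have u: "u1 = (\<not> u0)" "u2 = u0" by auto
  \<comment> \<open>Each of the two differences spans \<open>l - 1\<close> consecutive steps, so
    either one can be broken into a block \<open>Y\<close>. This is why indices up to
    \<open>2 * l - 2\<close> occur.\<close>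
  define z where "z = p * (a (l - 1) - a 0) + p * p * (a (2 * l - 2) - a (l - 1))"
  have "z \<le> n"
  proof -
    have "a (l - 1) \<le> a (2 * l - 2)" using l by (intro monoD[OF mono]) linarith
    then have "a (l - 1) - a 0 \<le> a (2 * l - 2)" by linarith
    then have "z \<le> p * a (2 * l - 2) + p * p * a (2 * l - 2)"
      unfolding z_def by (intro add_mono mult_mono) auto
    then show ?thesis using n by (simp add: algebra_simps)
  qed
  \<comment> \<open>Makes the second difference larger than every piece of the first, so that the
    repeated summand is a new value.\<close>
  have gap: "a (l - 1) \<le> a (2 * l - 2) - a (l - 1)"
  proof -
    have "a l \<le> a (2 * l - 2)" using l by (intro monoD[OF mono]) linarith
    moreover have "a (l - 1) \<le> a l - a (l - 1)" using d_ge[of "l - 1"] l by (simp add: d_def)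
    ultimately show ?thesis by linarith
  qed
  have "c z \<noteq> u1"
  proof (rule step[of p "p * (a (2 * l - 2) - a (l - 1))" 0 u1])
    show "p * (a (2 * l - 2) - a (l - 1)) \<notin> Y p 0"
    proof
      assume "p * (a (2 * l - 2) - a (l - 1)) \<in> Y p 0"
      then obtain i where i: "i < l - 1" "a (2 * l - 2) - a (l - 1) = d i"
        using p1 by (auto simp: Y_def)
      then show False using gap d_less[of i] monoD[OF mono, of "Suc i" "l - 1"] by simp
    qed
    show "v > 0 \<and> c v = u1" if "v \<in> Y p 0" for v
      using that cold d_pos p1 by (auto simp: Y_def)
    show "0 < p * (a (2 * l - 2) - a (l - 1))" using gap pos[of "l - 1"] p1 by simp
    show "c (p * (a (2 * l - 2) - a (l - 1))) = u1" using col[of "l - 1" "2 * l - 2"] l by simp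
    show "z = \<Sum>(Y p 0) + p * (p * (a (2 * l - 2) - a (l - 1)))"
      using sumY[OF p1, of 0] by (simp add: z_def)
  qed (use l p1 \<open>z \<le> n\<close> in auto)
  moreover have "c z \<noteq> u0"
  proof (rule step[of "p * p" "a (l - 1) - a 0" "l - 1" u0])
    show "a (l - 1) - a 0 \<notin> Y (p * p) (l - 1)"
    proof
      assume "a (l - 1) - a 0 \<in> Y (p * p) (l - 1)"
      then obtain i where i: "a (l - 1) - a 0 = p * p * d (l - 1 + i)" unfolding Y_def by blast
      have "a (l - 1) \<le> d (l - 1 + i)"
        using d_ge[of "l - 1 + i"] monoD[OF mono, of "l - 1" "l - 1 + i"] by simp
      also have "\<dots> \<le> p * p * d (l - 1 + i)" using p1 by simp
      finally show False using i pos[of 0] pos[of "l - 1"] by simp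
    qed
    show "v > 0 \<and> c v = u0" if "v \<in> Y (p * p) (l - 1)" for v
      using that cold d_pos p1 u by (auto simp: Y_def)
    show "0 < a (l - 1) - a 0"
    proof -
      have "a 1 \<le> a (l - 1)" using l by (intro monoD[OF mono]) linarith
      then show ?thesis using d_pos[of 0] by (simp add: d_def)
    qed
    show "c (a (l - 1) - a 0) = u0" using col[of 0 "l - 1"] l by simp
    have "l - 1 + (l - 1) = 2 * l - 2" by simp
    then show "z = \<Sum>(Y (p * p) (l - 1)) + p * (a (l - 1) - a 0)"
      using sumY[of "p * p" "l - 1"] p1 by (simp add: z_def)
  qed (use l p1 \<open>z \<le> n\<close> in auto)
  ultimately show False using u by simp
qed

text \<open>Decodes the three colours that \<open>ex_not_avoids\<close> packs into binary
  digits.\<close>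

lemma three_bits_eqD:
  assumes "(if P then 1 else 0) + (if Q then 2 else 0) + (if R then 4 else 0 :: nat)
    = (if P' then 1 else 0) + (if Q' then 2 else 0) + (if R' then 4 else 0)"
  shows "P = P' \<and> Q = Q' \<and> R = R'"
  using assms by (cases P; cases Q; cases R; cases P'; cases Q'; cases R'; simp)

text \<open>Ramsey's theorem for pairs of exponents: a pair is coloured by the colours of the
  difference of the two powers of \<open>B\<close>, scaled by \<open>1\<close>, \<open>p\<close> and
  \<open>p * p\<close>, which gives 8 classes. A homogeneous set of \<open>2 * l - 1\<close>
  exponents suffices.\<close>

lemma ex_not_avoids:
  assumes l: "2 \<le> l" "l \<le> k"
  shows "\<exists>n. \<forall>c. \<not> avoids k l n c"
proof -
  define p where "p = k - l + 1"
  define m where "m = 2 * l - 1"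
  obtain N :: nat where N: "partn_lst {..<N} (replicate 8 m) 2" using ramsey_full by blast
  define B where "B = p + 2"
  show ?thesis
  proof (intro exI allI notI)
    fix c assume avoids: "avoids k l ((p * p + p) * B ^ N) c"
    define D where "D w e = c (w * (B ^ Max e - B ^ Min e))" for w and e :: "nat set"
    define f where "f e = (if D 1 e then 1 else 0) + (if D p e then 2 else 0)
      + (if D (p * p) e then 4 else 0 :: nat)" for e
    have "f \<in> nsets {..<N} 2 \<rightarrow> {..<8}" by (auto simp: f_def)
    from partn_lstE[OF N this] obtain i H where
      H: "i < 8" "H \<in> nsets {..<N} (replicate 8 m ! i)" "f ` nsets H 2 \<subseteq> {i}" by auto
    then have H': "H \<subseteq> {..<N}" "finite H" "card H = m" by (auto simp: nsets_def)
    define xs where "xs = sorted_list_of_set H"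
    have xs: "length xs = m" "set xs = H" "sorted_wrt (<) xs"
      using H' by (auto simp: xs_def)
    \<comment> \<open>Past the homogeneous set, \<open>h\<close> continues with \<open>N + i\<close>
      only to be strictly increasing everywhere, as \<open>not_avoids_differences\<close> asks for
      growth at every index.\<close>
    define h where "h i = (if i < m then xs ! i else N + i)" for i
    have hH: "h i \<in> H" if "i < m" for i using that xs by (auto simp: h_def)
    have "strict_mono h"
    proof (rule strict_monoI)
      fix i j :: nat assume ij: "i < j"
      have "h i < N" if "i < m" using hH[OF that] H' by auto
      then show "h i < h j"
        using ij xs sorted_wrt_nth_less[OF xs(3) ij] by (cases "i < m") (auto simp: h_def)
    qed
    have fh: "f {h i, h j} = f {h 0, h 1}" "Max {h i, h j} = h j" "Min {h i, h j} = h i"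
      if "i < j" "j < m" for i j
    proof -
      have less: "h i < h j" "h 0 < h 1" using that \<open>strict_mono h\<close> by (auto simp: strict_mono_less)
      have "{h i, h j} \<in> nsets H 2" "{h 0, h 1} \<in> nsets H 2"
        using that hH less l by (auto simp: m_def)
      then show "f {h i, h j} = f {h 0, h 1}" using H(3) by blast
      show "Max {h i, h j} = h j" "Min {h i, h j} = h i" using less by auto
    qed
    have Deq: "D w {h i, h j} = D w {h 0, h 1}" if "i < j" "j < m" "w = 1 \<or> w = p \<or> w = p * p" for i j w
      using three_bits_eqD[OF fh(1)[OF that(1,2), unfolded f_def]] that(3) by blast
    define a where "a i = B ^ h i" for i
    have col: "c (w * (a j - a i)) = D w {h 0, h 1}" if "i < j" "j < m" "w = 1 \<or> w = p \<or> w = p * p" for i j w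
      using Deq[OF that] fh(2,3)[OF that(1,2)] by (simp add: D_def a_def)
    have "a (2 * l - 2) \<le> B ^ N"
    proof -
      have "2 * l - 2 < m" using l by (simp add: m_def)
      then have "h (2 * l - 2) < N" using hH H' by blast
      then show ?thesis by (simp add: a_def B_def power_increasing)
    qed
    then have n: "(p * p + p) * a (2 * l - 2) \<le> (p * p + p) * B ^ N" by simp
    have growth: "(p + 2) * a i \<le> a (Suc i)" for i
    proof -
      have "Suc (h i) \<le> h (Suc i)" using \<open>strict_mono h\<close> by (simp add: Suc_le_eq strict_mono_less)
      then have "B ^ Suc (h i) \<le> B ^ h (Suc i)" by (intro power_increasing) (auto simp: B_def)
      then show ?thesis by (simp add: a_def B_def)
    qed
    have "1 \<le> a i" for i by (simp add: a_def B_def)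
    from not_avoids_differences[OF avoids l p_def this growth n,
        of "D 1 {h 0, h 1}" "D p {h 0, h 1}" "D (p * p) {h 0, h 1}"]
    show False using col[of _ _ 1] col[of _ _ p] col[of _ _ "p * p"] l by (auto simp: m_def)
  qed
qed

subsection \<open>The upper bound for large \<open>k\<close>\<close>

lemma sum_interval_nat: "\<Sum>{m..<m + l} = l * m + l * (l - 1) div 2" for m l :: nat
proof (induction l)
  case (Suc l)
  have "Suc l * (Suc l - 1) div 2 = l + l * (l - 1) div 2"
    by (cases l) (auto simp: algebra_simps)
  with Suc show ?case by simp
qed simp

lemma sum_le_card_mult: "V \<subseteq> {1..L} \<Longrightarrow> \<Sum>V \<le> card V * L" for V :: "nat set"
  using sum_bounded_above[of V "\<lambda>x. x" L] by (simp add: subset_iff)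

text \<open>All \<open>k\<close> summands are at most \<open>L\<close>, so \<open>k * L\<close>
  bounds every such sum and no size check per sum is needed later.\<close>

lemma avoids_sum_bounded:
  assumes "avoids k l n c" "l \<le> k" "V \<subseteq> {1..L}" "card V = l" "\<And>v. v \<in> V \<Longrightarrow> c v = d"
    and "a \<in> V" "b \<in> V" "a \<le> b" "s \<le> k - l" "k * L \<le> n"
  shows "\<Sum>V + (k - l) * a + s * (b - a) \<le> k * L"
    and "c (\<Sum>V + (k - l) * a + s * (b - a)) \<noteq> d"
proof -
  have "\<Sum>V \<le> l * L" using sum_le_card_mult[OF assms(3)] assms(4) by simp
  moreover have "s * (b - a) \<le> (k - l) * (b - a)" using assms by (intro mult_le_mono1) auto
  moreover have "(k - l) * a + (k - l) * (b - a) = (k - l) * b" using assms(8) by (simp flip: distrib_left)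
  moreover have "(k - l) * b \<le> (k - l) * L" using assms by (intro mult_le_mono2) auto
  moreover have "l * L + (k - l) * L = k * L" using assms(2) by (simp flip: distrib_right)
  ultimately show le: "\<Sum>V + (k - l) * a + s * (b - a) \<le> k * L" by linarith
  have "finite V" using assms(3) finite_subset by blast
  then show "c (\<Sum>V + (k - l) * a + s * (b - a)) \<noteq> d"
    using assms le by (intro avoids_sum[OF assms(1,2), of V d a b s]) auto
qed

text \<open>A sum \<open>y\<close> over \<open>W\<close> has the colour of \<open>V\<close> and vice versa, so sums over \<open>V\<close> with one summand \<open>y\<close>
  and sums over \<open>W\<close> with one summand \<open>y'\<close> have opposite colours. With two consecutive elements in \<open>W\<close>
  the multiplicities can be chosen such that the two sums agree.\<close>
lemma not_avoids_consecutive: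
  assumes avoids: "avoids k l n c" and l: "2 \<le> l" "l \<le> L"
    and k: "L * L + 2 * L \<le> k" and n: "k * k \<le> n"
    and V: "V \<subseteq> {1..L}" "card V = l" "\<And>v. v \<in> V \<Longrightarrow> c v = d"
    and W: "W \<subseteq> {1..L}" "card W = l" "\<And>w. w \<in> W \<Longrightarrow> c w = (\<not> d)"
    and b: "b \<in> W" "Suc b \<in> W"
  shows False
proof -
  have fin: "finite V" "finite W" using V(1) W(1) finite_subset by blast+
  have lk: "l \<le> k" using l k by linarith
  have kL: "2 * (k * L) \<le> n"
  proof -
    have "k * (2 * L) \<le> k * k" using k by (intro mult_le_mono2) linarith
    then show ?thesis using n by linarith
  qed
  obtain a1 a2 where a: "a1 \<in> V" "a2 \<in> V" "a1 < a2"
  proof -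
    have "\<exists>x\<in>V. \<exists>y\<in>V. x \<noteq> y"
      using V(2) l card_le_Suc0_iff_eq[OF fin(1)] by fastforce
    then show thesis using that by (metis linorder_neqE_nat)
  qed
  have le: "a1 \<le> L" "a2 \<le> L" "b + 1 \<le> L" "1 \<le> a1" "1 \<le> b" using a b V(1) W(1) by auto
  obtain e where e: "a2 = a1 + Suc e" using a(3) less_iff_Suc_add by auto
  define q where "q = k - l"
  \<comment> \<open>With \<open>s'\<close> summands \<open>a1\<close> raised to \<open>a2\<close> in
    \<open>y'\<close>, equality of the two final sums means
    \<open>s - a2 = s' * Suc e - (b + 1)\<close>. The choice \<open>s' = b + 1\<close> leads to this
    \<open>s\<close>.\<close>
  define s where "s = a2 + (b + 1) * e"
  have "(b + 1) * e \<le> L * L" using le e by (intro mult_le_mono) auto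
  then have q: "s \<le> q" "b + 1 \<le> q" "L \<le> q" using k l le by (auto simp: s_def q_def)
  define y where "y = \<Sum>W + q * b + s"
  define y' where "y' = \<Sum>V + q * a1 + (b + 1) * Suc e"
  define z where "z = \<Sum>V + \<Sum>W + q * a1 + q * b + (b + 1) * e"
  have y: "y \<le> k * L" "c y = d"
    using avoids_sum_bounded[OF avoids lk W b(1,2), of s] q kL by (auto simp: y_def q_def)
  have y': "y' \<le> k * L" "c y' \<noteq> d"
    using avoids_sum_bounded[OF avoids lk V a(1,2), of "b + 1"] a(3) e q kL by (auto simp: y'_def q_def)
  have "a1 \<le> \<Sum>V" "b \<le> \<Sum>W"
    using member_le_sum[OF a(1), of "\<lambda>x. x"] member_le_sum[OF b(1), of "\<lambda>x. x"] fin by simp_all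
  then have pos: "0 < \<Sum>V" "0 < \<Sum>W" using le by linarith+
  have "q \<le> q * b" "q \<le> q * a1" using le by auto
  then have big: "L < y" "L < y'" using q pos unfolding y_def y'_def by linarith+
  have rest: "\<Sum>(V - {a2}) + a2 = \<Sum>V" "\<Sum>(W - {b + 1}) + (b + 1) = \<Sum>W"
    using sum.remove[OF fin(1) a(2), of "\<lambda>x. x"] sum.remove[OF fin(2) b(2), of "\<lambda>x. x"] by simp_all
  have zy: "z = \<Sum>(V - {a2}) + y + q * a1"
    using rest(1) by (simp add: z_def y_def s_def)
  have zy': "z = \<Sum>(W - {b + 1}) + y' + q * b"
    using rest(2) by (simp add: z_def y'_def)
  have zn: "z \<le> n"
  proof -
    have "z \<le> y + y'" by (simp add: z_def y_def y'_def)
    then show ?thesis using y y' kL by linarith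
  qed
  have "y \<notin> V" "y' \<notin> W" using big V(1) W(1) by auto
  have "c z \<noteq> d"
  proof (rule avoids_sum[OF avoids lk])
    show "z = \<Sum>(insert y (V - {a2})) + (k - l) * a1 + 0 * (a1 - a1)"
      using zy \<open>y \<notin> V\<close> fin by (simp add: q_def)
    show "card (insert y (V - {a2})) = l" using \<open>y \<notin> V\<close> V(2) a fin l by simp
    show "v > 0 \<and> c v = d" if "v \<in> insert y (V - {a2})" for v
      using that big V y by (cases "v = y") auto
  qed (use fin a zn in auto)
  moreover have "c z \<noteq> (\<not> d)"
  proof (rule avoids_sum[OF avoids lk])
    show "z = \<Sum>(insert y' (W - {b + 1})) + (k - l) * b + 0 * (b - b)"
      using zy' \<open>y' \<notin> W\<close> fin by (simp add: q_def)
    show "card (insert y' (W - {b + 1})) = l" using \<open>y' \<notin> W\<close> W(2) b fin l by simp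
    show "v > 0 \<and> c v = (\<not> d)" if "v \<in> insert y' (W - {b + 1})" for v
      using that big W y' by (cases "v = y'") auto
  qed (use fin b zn in auto)
  ultimately show False by simp
qed

text \<open>The odd numbers \<open>V\<close> and the even numbers \<open>W\<close> yield sums in two
  progressions of step 2 with opposite colours. For even \<open>k\<close> the progressions meet. For
  odd \<open>k\<close> they have different parity, and a sum over \<open>W\<close> serves as a
  summand to correct this.\<close>

lemma not_avoids_alternating:
  assumes avoids: "avoids k l n c" and l: "2 \<le> l"
    and k: "l * l + 4 * l \<le> k" and n: "k * k \<le> n"
    and alt: "\<And>i. 1 \<le> i \<Longrightarrow> i \<le> 2 * l \<Longrightarrow> c i = (odd i = d)"
  shows False
proof -
  have lk: "l \<le> k" using k by linarith
  define q where "q = k - l"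
  have kq: "k = l + q" using lk by (simp add: q_def)
  define V where "V = (\<lambda>i. 2 * i + 1) ` {..<l}"
  define W where "W = (\<lambda>i. 2 * i + 2) ` {..<l}"
  have inj: "inj_on (\<lambda>i. 2 * i + 1) {..<l}" "inj_on (\<lambda>i. 2 * i + 2) {..<l}"
    by (auto simp: inj_on_def)
  have card: "card V = l" "card W = l" using inj by (simp_all add: V_def W_def card_image)
  have sums: "\<Sum>V = l * l" "\<Sum>W = l * l + l"
  proof -
    have "(\<Sum>i<l. 2 * i + 1) = l * l" "(\<Sum>i<l. 2 * i + 2) = l * l + l" for l :: nat
      by (induction l) auto
    then show "\<Sum>V = l * l" "\<Sum>W = l * l + l"
      using inj by (simp_all add: V_def W_def sum.reindex)
  qed
  have sub: "V \<subseteq> {1..2 * l}" "W \<subseteq> {1..2 * l}" by (auto simp: V_def W_def)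
  have colV: "c v = d" if "v \<in> V" for v
    using that alt[of v] sub(1) by (auto simp: V_def)
  have colW: "c v = (\<not> d)" if "v \<in> W" for v
    using that alt[of v] sub(2) by (auto simp: W_def)
  have mem: "1 \<in> V" "3 \<in> V" "2 \<in> W" "4 \<in> W"
    using l by (auto simp: V_def W_def image_iff intro: bexI[of _ 0] bexI[of _ 1])
  have kn: "k * (2 * l) \<le> n"
  proof -
    have "k * (2 * l) \<le> k * k" using k by (intro mult_le_mono2) linarith
    then show ?thesis using n by linarith
  qed
  have odds: "c (l * l + q + 2 * s) \<noteq> d" if "s \<le> q" for s
    using avoids_sum_bounded(2)[OF avoids lk sub(1) card(1) colV mem(1,2) _ _ kn, of s] that
    by (simp add: sums mult.commute flip: q_def)
  have evens: "c (l * l + l + 2 * q + 2 * s) = d" "l * l + l + 2 * q + 2 * s \<le> k * (2 * l)" if "s \<le> q" for s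
    using avoids_sum_bounded[OF avoids lk sub(2) card(2) colW mem(3,4) _ _ kn, of s] that
    by (simp_all add: sums mult.commute flip: q_def)
  show False
  proof (cases "even k")
    case True
    then obtain h where h: "k = 2 * h" by (elim evenE)
    have "h \<le> q" using h kq k by linarith
    moreover have "l * l + q + 2 * h = l * l + l + 2 * q + 2 * 0" using h kq by simp
    ultimately show False using odds[of h] evens(1)[of 0] by (metis le0)
  next
    case False
    \<comment> \<open>The least of these sums over \<open>W\<close>. It has colour \<open>d\<close>
      and replaces 3 in \<open>V\<close>, so that the new sum \<open>z\<close> falls into the
      progression of \<open>W\<close>.\<close>
    define e where "e = l * l + l + 2 * q"
    have "even e" by (simp add: e_def)
    then have eV: "e \<notin> V" by (auto simp: V_def)
    have sq: "4 \<le> l * l" using mult_le_mono[OF l l] by simp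
    have "even (q + l * l - 3)"
    proof -
      have "odd (q + l * l)" using False kq by auto
      then show ?thesis using sq by auto
    qed
    then obtain h where h: "q + l * l - 3 = 2 * h" by (elim evenE)
    have hq: "h \<le> q" using h k kq sq by linarith
    define z where "z = e + (l * l - 3) + q"
    have z: "z = l * l + l + 2 * q + 2 * h" using h sq by (simp add: z_def e_def)
    have finV: "finite V" by (simp add: V_def)
    have "c z \<noteq> d"
    proof (rule avoids_sum[OF avoids lk])
      have "\<Sum>(V - {3}) = l * l - 3" using sums(1) mem finV by (simp add: sum_diff1_nat)
      then show "z = \<Sum>(insert e (V - {3})) + (k - l) * 1 + 0 * (1 - 1)"
        using eV finV by (simp add: z_def q_def)
      show "card (insert e (V - {3})) = l" using eV card mem finV l by simp
      show "v > 0 \<and> c v = d" if "v \<in> insert e (V - {3})" for v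
        using that colV sub(1) evens(1)[of 0] sq l by (cases "v = e") (auto simp: e_def)
      show "z \<le> n" using evens(2)[OF hq] z kn by linarith
    qed (use finV mem in auto)
    then show False using evens(1)[OF hq] z by simp
  qed
qed

text \<open>Here the \<open>l - 1\<close> numbers \<open>y i\<close> are sums over \<open>V\<close> and have the colour of \<open>e\<close>. Together with \<open>e\<close> they sum
  to a number whose average is close to \<open>g\<close>, hence a sum over \<open>W\<close>.\<close>
lemma not_avoids_exception:
  assumes avoids: "avoids k l n c" and l: "2 \<le> l" "l \<le> L"
    and k: "4 * (l * l * L) + L \<le> k" and n: "k * k \<le> n"
    and e: "1 \<le> e" "e \<le> L" "c e = (\<not> d)"
    and V: "V \<subseteq> {1..L}" "card V = l" "\<And>v. v \<in> V \<Longrightarrow> c v = d" "a \<in> V" "Suc a \<in> V"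
    and W: "W \<subseteq> {1..L}" "card W = l" "\<And>w. w \<in> W \<Longrightarrow> c w = d" "g \<in> W" "Suc g \<in> W"
    and g: "g = (l - 1) * a + e"
  shows False
proof -
  obtain m where m: "l = Suc (Suc m)" using l(1) by (metis add_2_eq_Suc le_Suc_ex)
  define LL where "LL = l * l * L"
  have "l * L \<le> LL" "l * l \<le> LL" "L \<le> l * L"
    unfolding LL_def mult.assoc using l by (auto intro!: mult_le_mono)
  then have "l * L \<le> LL" "L \<le> LL" "l \<le> LL" "l * l \<le> LL" using l by linarith+
  note LL = this k[folded LL_def]
  have lk: "l \<le> k" using LL l by linarith
  have kn: "k * L \<le> n"
  proof -
    have "k * L \<le> k * k" using LL by (intro mult_le_mono2) linarith
    then show ?thesis using n by linarith
  qed
  define q where "q = k - l"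
  have q: "3 * LL + L \<le> q" using LL by (simp add: q_def)
  \<comment> \<open>The shift \<open>i\<close> keeps the \<open>y i\<close> distinct. The term
    \<open>\<Sum>W\<close> is built in so that their total contains the one copy of
    \<open>\<Sum>W\<close> needed for a sum over \<open>W\<close>.\<close>
  define y where "y i = \<Sum>V + q * a + (\<Sum>W + i)" for i
  define T where "T = (\<Sum>i<l - 1. i)"
  have "T \<le> (l - 1) * l" unfolding T_def using sum_bounded_above[of "{..<l - 1}" "\<lambda>i. i" l] by simp
  then have T: "T + l \<le> l * l" by (simp add: m)
  have sV: "\<Sum>V \<le> l * L" and sW: "\<Sum>W \<le> l * L"
    using sum_le_card_mult[OF V(1)] sum_le_card_mult[OF W(1)] V(2) W(2) by simp_all
  have cy: "c (y i) = (\<not> d)" if "i < l - 1" for i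
  proof -
    have "\<Sum>W + i \<le> q" using that sW LL q by linarith
    then show ?thesis using avoids_sum_bounded(2)[OF avoids lk V _ _ kn, of "\<Sum>W + i"]
      by (simp add: y_def flip: q_def)
  qed
  have a1: "1 \<le> a" using V by auto
  have "1 \<le> q" using q LL l by linarith
  have ye: "e < y i" for i
  proof -
    have "q \<le> q * a" using a1 by simp
    then show ?thesis using q e LL l unfolding y_def by linarith
  qed
  define Y where "Y = y ` {..<l - 1}"
  have inj: "inj_on y {..<l - 1}" by (auto simp: inj_on_def y_def)
  have eY: "e \<notin> Y" using ye by (force simp: Y_def)
  \<comment> \<open>What remains of \<open>z\<close> after subtracting
    \<open>\<Sum>W + q * g\<close>: the number of summands \<open>g\<close> to be raised to
    \<open>Suc g\<close>.\<close>
  define s where "s = (l - 1) * \<Sum>V + m * \<Sum>W + T + e"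
  define z where "z = \<Sum>(insert e Y) + q * e"
  have sumY: "\<Sum>Y = (l - 1) * (\<Sum>V + q * a + \<Sum>W) + T"
    using inj by (simp add: Y_def sum.reindex y_def T_def sum.distrib algebra_simps)
  have z: "z = \<Sum>W + q * g + s * (Suc g - g)"
  proof -
    have "\<Sum>(insert e Y) = e + \<Sum>Y" using eY by (simp add: Y_def)
    then show ?thesis by (simp add: z_def sumY s_def g m algebra_simps)
  qed
  have "s \<le> q"
  proof -
    have "(l - 1) * \<Sum>V \<le> l * (l * L)" "m * \<Sum>W \<le> l * (l * L)"
      using mult_le_mono[OF _ sV, of "l - 1" l] mult_le_mono[OF _ sW, of m l] m by simp_all
    moreover have "l * (l * L) = LL" by (simp add: LL_def)
    ultimately show ?thesis using q T e LL unfolding s_def by linarith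
  qed
  note W' = avoids_sum_bounded[OF avoids lk W _ this[unfolded q_def] kn, folded q_def, folded z]
  have "c z \<noteq> (\<not> d)"
  proof (rule avoids_sum[OF avoids lk])
    show "card (insert e Y) = l" using eY inj l by (simp add: Y_def card_image)
    show "v > 0 \<and> c v = (\<not> d)" if v: "v \<in> insert e Y" for v
    proof (cases "v = e")
      case False
      then obtain i where "i < l - 1" "v = y i" using v by (auto simp: Y_def)
      then show ?thesis using cy ye[of i] by simp
    qed (use e in simp)
    show "z = \<Sum>(insert e Y) + (k - l) * e + 0 * (e - e)" by (simp add: z_def q_def)
    show "z \<le> n" using W'(1) kn by simp
  qed (auto simp: Y_def)
  then show False using W'(2) by simp
qed

text \<open>Here \<open>d\<close> is red. Sums of small numbers make
  \<open>M, ..., M + l - 1\<close> blue, their least sum \<open>P\<close> is then red, and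
  \<open>P\<close> with \<open>1, ..., l - 1\<close> forbids red for the claimed value. A further
  blue number \<open>w\<close> forbids blue.\<close>

lemma not_avoids_initial_segment:
  assumes avoids: "avoids k l (schur_bound k l) c" and l: "2 \<le> l"
    and k: "l * l + 2 * l \<le> k"
    and col: "\<And>i. 1 \<le> i \<Longrightarrow> i \<le> Suc l \<Longrightarrow> c i = d"
  shows False
proof -
  have lk: "l \<le> k" using k by linarith
  define n where "n = schur_bound k l"
  obtain q where kq: "k = l + q" using lk le_Suc_ex by blast
  obtain j where j: "l = Suc (Suc j)" using l by (metis add_2_eq_Suc le_Suc_ex)
  define t1 where "t1 = (l - 1) * (l - 2) div 2"
  define t where "t = l * (l - 1) div 2"
  have t: "t = t1 + l - 1" by (simp add: t_def t1_def j algebra_simps)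
  have t1_le: "t1 \<le> l * l" unfolding t1_def
    by (rule order_trans[OF div_le_dividend]) (simp add: mult_le_mono)
  define M where "M = k + t"
  have n: "n = k * M + t + (k - 1) + t1"
    using schur_bound_alt[of l k] l lk by (simp add: n_def M_def t_def t1_def)
  have M0: "0 < M" using l lk by (simp add: M_def)
  define qM where "qM = q * M"
  define lM where "lM = l * M"
  have kM: "k * M = lM + qM" by (simp add: kq lM_def qM_def algebra_simps)
  note step = avoids_sum[OF avoids lk, folded n_def]
  have low: "c (M + i) = (\<not> d)" if "i < l" for i
  proof -
    have "c (M + i) \<noteq> d"
    proof (rule step[of "{1..<1 + l}" d 1 2 i])
      have "\<Sum>{1..<1 + l} = l + t" using sum_interval_nat[of 1 l] by (simp add: t_def)
      then show "M + i = \<Sum>{1..<1 + l} + (k - l) * 1 + i * (2 - 1)" by (simp add: M_def kq)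
      have "k * M \<ge> 2 * M" using l lk by (intro mult_le_mono1) simp
      then show "M + i \<le> n" using that lk by (simp add: n M_def)
    qed (use col that l k kq in auto)
    then show ?thesis by simp
  qed
  have colM: "c v = (\<not> d)" if "M \<le> v" "v < M + l" for v
    using low[of "v - M"] that by (simp add: less_diff_conv2)
  define P where "P = k * M + t"
  have cP: "c P = d"
  proof -
    have "c P \<noteq> (\<not> d)"
    proof (rule step[of "{M..<M + l}" _ M M 0])
      show "P = \<Sum>{M..<M + l} + (k - l) * M + 0 * (M - M)"
        unfolding sum_interval_nat P_def kM using kq by (simp add: t_def lM_def qM_def)
      show "v > 0 \<and> c v = (\<not> d)" if "v \<in> {M..<M + l}" for v
        using that colM M0 by auto
    qed (use l in \<open>auto simp: P_def n\<close>)
    then show ?thesis by simp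
  qed
  have cn: "c n \<noteq> d"
  proof (rule step[of "insert P {1..<1 + (l - 1)}" d 1 1 0])
    have "k * 1 \<le> k * M" using M0 by (intro mult_le_mono2) simp
    then have "l \<le> k * M" using lk by linarith
    then have "P \<notin> {1..<1 + (l - 1)}" using l by (auto simp: P_def)
    moreover have "\<Sum>{1..<1 + (l - 1)} = (l - 1) + t1"
      unfolding sum_interval_nat by (simp add: t1_def numeral_2_eq_2)
    ultimately show "n = \<Sum>(insert P {1..<1 + (l - 1)}) + (k - l) * 1 + 0 * (1 - 1)"
      "card (insert P {1..<1 + (l - 1)}) = l"
      using l lk by (simp_all add: n P_def)
    show "v > 0 \<and> c v = d" if "v \<in> insert P {1..<1 + (l - 1)}" for v
      using that col cP l by (auto simp: P_def M_def kq)
  qed (use l in auto)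
  \<comment> \<open>This is \<open>n\<close> minus \<open>M + ... + (M + l - 2)\<close> and minus
    \<open>(k - l) * M\<close>, so it completes a blue sum to \<open>n\<close>.\<close>
  define w where "w = t + 2 * k + j + t1"
  have cw: "c w = (\<not> d)"
  proof -
    have "c w \<noteq> d"
    proof (rule step[of "{2..<2 + l}" d 2 3 "j + t1"])
      show "w = \<Sum>{2..<2 + l} + (k - l) * 2 + (j + t1) * (3 - 2)"
        unfolding sum_interval_nat w_def t_def[symmetric] by (simp add: kq)
      show "j + t1 \<le> k - l" using t1_le k j by simp
      have "2 * M \<le> k * M" using l lk by (intro mult_le_mono1) simp
      then show "w \<le> n" using j kq by (simp add: w_def n M_def)
    qed (use col l in auto)
    then show ?thesis by simp
  qed
  have w0: "0 < w" using l lk by (simp add: w_def)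
  have "c n \<noteq> (\<not> d)"
  proof (rule step[of "insert w {M..<M + (l - 1)}" _ M M 0])
    have wn: "w \<notin> {M..<M + (l - 1)}" using lk by (simp add: w_def M_def j)
    then show "card (insert w {M..<M + (l - 1)}) = l" using l by simp
    have "\<Sum>{M..<M + (l - 1)} = (l - 1) * M + t1"
      unfolding sum_interval_nat by (simp add: t1_def numeral_2_eq_2)
    moreover have "l * M = (l - 1) * M + M" by (simp add: j)
    ultimately show "n = \<Sum>(insert w {M..<M + (l - 1)}) + (k - l) * M + 0 * (M - M)"
      using wn kM t by (simp add: n w_def lM_def qM_def kq M_def j)
    show "v > 0 \<and> c v = (\<not> d)" if "v \<in> insert w {M..<M + (l - 1)}" for v
      using that colM M0 cw w0 by auto
  qed (use l in auto)
  then show False using cn by simp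
qed

lemma not_avoids_bound:
  assumes l: "2 \<le> l" and k: "100 * l ^ 4 \<le> k"
  shows "\<not> avoids k l (schur_bound k l) c"
proof
  assume avoids: "avoids k l (schur_bound k l) c"
  \<comment> \<open>Leaves room for \<open>(l - 1) * a + e + 1\<close> with
    \<open>a \<le> 4 * l\<close> and \<open>e \<le> l + 1\<close>.\<close>
  define L where "L = 4 * l * l"
  define S where "S = l * l * (l * l)"
  have ll: "2 * l \<le> l * l" using l by simp
  have lll: "4 * (l * l) \<le> S" unfolding S_def using mult_le_mono[OF l l] by (intro mult_le_mono1) simp
  have LS: "L = 4 * (l * l)" "L * L = 16 * S" "4 * (l * l * L) = 16 * S"
    by (simp_all add: L_def S_def)
  have kS: "100 * S \<le> k" using k by (simp add: S_def power4_eq_xxxx mult.assoc)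
  have n: "k * k \<le> schur_bound k l" by (simp add: schur_bound_def power2_eq_square)
  have kl: "l \<le> L" "l * l + 4 * l \<le> k" "L * L + 2 * L \<le> k" "4 * (l * l * L) + L \<le> k" "Suc l \<le> L"
    "2 * l \<le> L"
    \<comment> \<open>The largest threshold is
      \<open>L * L + 2 * L = 16 * l ^ 4 + 8 * l ^ 2\<close>, well below
      \<open>100 * l ^ 4\<close>.\<close>
    using kS lll ll LS l by linarith+
  define R where "R d = {i \<in> {1..L}. c i = d}" for d
  have RL: "R d \<subseteq> {1..L}" "finite (R d)" for d by (auto simp: R_def)
  have extend: "\<exists>V. {a, Suc a} \<subseteq> V \<and> V \<subseteq> R d \<and> card V = l"
    if "a \<in> R d" "Suc a \<in> R d" "l \<le> card (R d)" for a d
  proof -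
    have "card {a, Suc a} \<le> l" using l by simp
    from exists_subset_between[OF this that(3)] show ?thesis using that RL(2) by auto
  qed
  have split: "card (R d) + card (R (\<not> d)) = L" for d
  proof -
    have "R d \<union> R (\<not> d) = {1..L}" "R d \<inter> R (\<not> d) = {}" by (auto simp: R_def)
    then show ?thesis using card_Un_disjoint[of "R d" "R (\<not> d)"] RL(2) by simp
  qed
  show False
  proof (cases "\<forall>d. l \<le> card (R d)")
    case True
    show False
    proof (cases "\<exists>b. 1 \<le> b \<and> Suc b \<le> L \<and> c (Suc b) = c b")
      case True
      then obtain b where b: "1 \<le> b" "Suc b \<le> L" "c (Suc b) = c b" by blast
      obtain W where W: "{b, Suc b} \<subseteq> W" "W \<subseteq> R (c b)" "card W = l"
        using extend[of b "c b"] b \<open>\<forall>d. l \<le> card (R d)\<close> by (auto simp: R_def)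
      obtain V where V: "V \<subseteq> R (\<not> c b)" "card V = l"
        using obtain_subset_with_card_n[of l "R (\<not> c b)"] \<open>\<forall>d. l \<le> card (R d)\<close> by blast
      show False
        by (rule not_avoids_consecutive[OF avoids l kl(1,3) n, of V "\<not> c b" W b])
          (use V W in \<open>auto simp: R_def\<close>)
    next
      case False
      have alt: "c i = (odd i = c 1)" if "1 \<le> i" "i \<le> L" for i
        using that
      proof (induction i rule: nat_induct_at_least)
        case (Suc i)
        then have "c (Suc i) = (\<not> c i)" using False by blast
        also have "c i = (odd i = c 1)" using Suc by simp
        also have "(\<not> (odd i = c 1)) = (odd (Suc i) = c 1)" by auto
        finally show ?case .
      qed simp
      show False
      proof (rule not_avoids_alternating[OF avoids l kl(2) n])
        fix i assume "1 \<le> i" "i \<le> 2 * l"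
        with kl(6) show "c i = (odd i = c 1)" by (intro alt) linarith+
      qed
    qed
  next
    case False
    then obtain d' where "card (R d') < l" by (auto simp: not_le)
    then obtain d where d: "card (R (\<not> d)) < l" using that[of "\<not> d'"] by simp
    show False
    proof (cases "\<exists>e. 1 \<le> e \<and> e \<le> Suc l \<and> c e = (\<not> d)")
      case True
      then obtain e where e: "1 \<le> e" "e \<le> Suc l" "c e = (\<not> d)" by blast
      \<comment> \<open>Each of the four injections used below sends at most \<open>l - 1\<close>
        arguments to the rare colour, so among \<open>4 * l\<close> candidates some \<open>a\<close>
        is good for all four.\<close>
      define B where "B f = {a \<in> {1..4 * l}. f a \<in> R (\<not> d)}" for f :: "nat \<Rightarrow> nat"
      define g where "g a = (l - 1) * a + e" for a
      have B: "card (B f) \<le> l - 1" if "inj f" for f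
      proof -
        have "card (B f) \<le> card (R (\<not> d))"
          by (rule card_inj_on_le[of f]) (use that RL in \<open>auto simp: B_def inj_on_def\<close>)
        then show ?thesis using d by simp
      qed
      have inj_g: "inj g" using l by (auto simp: inj_def g_def)
      have "card (B (\<lambda>a. a) \<union> B Suc \<union> B g \<union> B (\<lambda>a. Suc (g a)))
        \<le> card (B (\<lambda>a. a)) + card (B Suc) + card (B g) + card (B (\<lambda>a. Suc (g a)))"
        by (intro order_trans[OF card_Un_le] add_mono order_refl)
      also have "\<dots> \<le> (l - 1) + (l - 1) + (l - 1) + (l - 1)"
        using inj_g by (intro add_mono B) (auto simp: inj_def)
      also have "\<dots> < card {1..4 * l}" using l by simp
      finally have "\<not> {1..4 * l} \<subseteq> B (\<lambda>a. a) \<union> B Suc \<union> B g \<union> B (\<lambda>a. Suc (g a))"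
        using card_mono[of "B (\<lambda>a. a) \<union> B Suc \<union> B g \<union> B (\<lambda>a. Suc (g a))" "{1..4 * l}"]
        by (auto simp: B_def)
      then obtain a where "a \<in> {1..4 * l}"
        "a \<notin> B (\<lambda>a. a)" "a \<notin> B Suc" "a \<notin> B g" "a \<notin> B (\<lambda>a. Suc (g a))" by blast
      then have a: "1 \<le> a" "a \<le> 4 * l" "a \<notin> R (\<not> d)" "Suc a \<notin> R (\<not> d)"
        "g a \<notin> R (\<not> d)" "Suc (g a) \<notin> R (\<not> d)" by (simp_all add: B_def)
      have "(l - 1) * a \<le> (l - 1) * (4 * l)" using a by (intro mult_le_mono2)
      moreover have "(l - 1) * (4 * l) + 4 * l = L" by (cases l) (auto simp: L_def algebra_simps)
      ultimately have gL: "Suc (g a) \<le> L" using e l unfolding g_def by linarith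
      have "l * 4 + 1 \<le> L" using ll LS l by linarith
      then have mem: "a \<in> R d" "Suc a \<in> R d" "g a \<in> R d" "Suc (g a) \<in> R d"
        using a gL e by (auto simp: R_def g_def)
      have "l \<le> card (R d)" using split[of d] d kl by linarith
      then obtain V W where "{a, Suc a} \<subseteq> V" "V \<subseteq> R d" "card V = l"
        "{g a, Suc (g a)} \<subseteq> W" "W \<subseteq> R d" "card W = l"
        using extend mem by meson
      then show False
        by (intro not_avoids_exception[OF avoids l kl(1,4) n, of e d V a W "g a"])
          (use e kl(5) in \<open>auto simp: R_def g_def\<close>)
    next
      \<comment> \<open>The rare colour is absent from \<open>1, ..., l + 1\<close>, so this segment
        has the single colour \<open>d\<close>.\<close>
      case False
      then show False
        using not_avoids_initial_segment[OF avoids l, of d] kl ll kS by auto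
    qed
  qed
qed

theorem theorem1p1:
  "(\<forall>k l :: nat. 2 \<le> l \<and> l \<le> k \<longrightarrow>
      real (schur_number 2 k l) \<ge>
        real k ^ 2 + ((real l + 1) * (real l - 2) / 2 + 2) * real k + real l * (real l - 2))
   \<and> (\<forall>l :: nat. l \<ge> 2 \<longrightarrow>
      (\<exists>K :: nat. K \<ge> 1 \<and> (\<forall>k :: nat. k \<ge> K \<and> k \<ge> l \<longrightarrow>
        real (schur_number 2 k l) =
          real k ^ 2 + ((real l + 1) * (real l - 2) / 2 + 2) * real k + real l * (real l - 2))))
   \<and> (\<forall>k :: nat. k \<ge> 3 \<longrightarrow> schur_number 2 k 2 = k ^ 2 + 2 * k)"
proof (intro conjI allI impI)
  fix k l :: nat
  assume "2 \<le> l \<and> l \<le> k"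
  then show "real (schur_number 2 k l) \<ge>
      real k ^ 2 + ((real l + 1) * (real l - 2) / 2 + 2) * real k + real l * (real l - 2)"
    using schur_number_ge_bound[of l k] ex_not_avoids[of l k] real_schur_bound[of l k] by simp
next
  fix l :: nat
  assume l: "2 \<le> l"
  show "\<exists>K :: nat. K \<ge> 1 \<and> (\<forall>k :: nat. k \<ge> K \<and> k \<ge> l \<longrightarrow>
      real (schur_number 2 k l) =
        real k ^ 2 + ((real l + 1) * (real l - 2) / 2 + 2) * real k + real l * (real l - 2))"
  proof (intro exI conjI allI impI)
    show "1 \<le> 100 * l ^ 4" using l by (simp add: Suc_le_eq)
    fix k
    assume "100 * l ^ 4 \<le> k \<and> l \<le> k"
    then have "schur_number 2 k l = schur_bound k l"
      using schur_number_eq_bound[OF l] not_avoids_bound[OF l] by blast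
    then show "real (schur_number 2 k l) =
        real k ^ 2 + ((real l + 1) * (real l - 2) / 2 + 2) * real k + real l * (real l - 2)"
      using real_schur_bound[OF l] by simp
  qed
next
  fix k :: nat
  assume "3 \<le> k"
  moreover have "schur_bound k 2 = k ^ 2 + 2 * k" by (simp add: schur_bound_def)
  ultimately show "schur_number 2 k 2 = k ^ 2 + 2 * k"
    using schur_number_eq_bound[of 2 k] not_avoids_2[of k] by simp
qed

end
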